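(* Let $$G(p)=\frac{3\pi}{2\sqrt2}\sum_{n=1}^\infty\frac{\chi(n)\,n}{(-p+n^2\pi^2/6)^{5/2}}.$$ Then for $\Re(x)>0$ the median Laplace transform $S^{\mathrm{med}}(x)$ of $G(p)$ is given by $$S^{\mathrm{med}}(x)=\frac{12\sqrt3}{\pi^{3/2}}\sum_{n=1}^\infty\frac{\chi(n)}{n^2}\,\mathcal{E}\left(n\pi\sqrt{\frac{x}{6}}\right)-1 .$$
   Context: $\chi$ is the primitive character of conductor $12$: $\chi(n)=1$ if $n\equiv1,11$, $\chi(n)=-1$ if $n\equiv5,7$, and $\chi(n)=0$ otherwise (mod $12$). $\mathrm{Erfi}(x)=\frac{2}{\sqrt\pi}\int_0^xe^{t^2}\,dt$ is the complex error function, and $\mathcal{E}(x)=e^{-x^2}x^3\,\mathrm{Erfi}(x)-\frac{x^2}{\sqrt\pi}$. The square root is the principal one. The function $G$ has its singularities in $\mathcal{N}=\{n^2\pi^2/6\mid n\ge1,\ \chi(n)\ne0\}\subset(0,\infty)$; the branch of $(-p+n^2\pi^2/6)^{-5/2}$ is positive for $0\le p<n^2\pi^2/6$. The median Laplace transform of $G$ is $$S^{\mathrm{med}}(x)=\frac12\left(\int_{\gamma_+}e^{-px}G(p)\,dp+\int_{\gamma_-}e^{-px}G(p)\,dp\right),$$ where $\gamma_+$ (resp. $\gamma_-$) is a path from $0$ to $\infty$ following the positive real axis and avoiding every point of $\mathcal{N}$ from above (resp. from below); equivalently a ray $\arg p=\theta$ (resp. $\arg p=-\theta$) with $\theta>0$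 small depending on $x$. (No constant term is added to the Laplace transform here.) *)

theory Defs
  imports "HOL-Complex_Analysis.Complex_Analysis"
begin

definition chi12 :: "nat \<Rightarrow> complex" where
  "chi12 n = (if n mod 12 \<in> {1, 11} then 1 else if n mod 12 \<in> {5, 7} then -1 else 0)"

definition Erfi :: "complex \<Rightarrow> complex" where
  "Erfi x = 2 / of_real (sqrt pi) * contour_integral (linepath 0 x) (\<lambda>t. exp (t ^ 2))"

definition calE :: "complex \<Rightarrow> complex" where
  "calE x = exp (- (x ^ 2)) * x ^ 3 * Erfi x - x ^ 2 / of_real (sqrt pi)"

text \<open>
  The series starts at the index 1, hence the occurrences of \<^term>\<open>Suc n\<close>.
  The principal power is positive for real \<^term>\<open>p\<close> to the left of the singularity of the
  summand, and its cut is the part of the real axis to the right of it. Hence on the open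
  upper and lower half planes \<open>G\<close> is the analytic continuation of its germ at 0 from above
  and from below, respectively. On the cuts themselves the value of \<open>G\<close> is an arbitrary
  convention; no path used below meets them.
\<close>

definition G :: "complex \<Rightarrow> complex" where
  "G p = of_real (3 * pi / (2 * sqrt 2)) *
     (\<Sum>n. chi12 (Suc n) * of_nat (Suc n) /
        ((- p + of_real (real (Suc n) ^ 2 * pi ^ 2 / 6)) powr (5/2)))"

text \<open>The integral of \<open>exp (- p * x) * f p\<close> over the ray \<open>p = r * cis \<theta>\<close>, \<open>r \<ge> 0\<close>.\<close>

definition has_ray_laplace :: "(complex \<Rightarrow> complex) \<Rightarrow> real \<Rightarrow> complex \<Rightarrow> complex \<Rightarrow> bool" where
  "has_ray_laplace f \<theta> x I \<longleftrightarrow>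
     ((\<lambda>r::real. exp (- (of_real r * cis \<theta>) * x) * f (of_real r * cis \<theta>) * cis \<theta>)
        has_integral I) {0..}"

text \<open>
  The average of the two lateral Laplace transforms. How small the angle has to be depends on
  \<open>x\<close>; the values \<open>I\<close> and \<open>J\<close> do not depend on the angle, so the median Laplace transform
  is unique if it exists.
\<close>

definition has_median_laplace :: "(complex \<Rightarrow> complex) \<Rightarrow> complex \<Rightarrow> complex \<Rightarrow> bool" where
  "has_median_laplace f x S \<longleftrightarrow>
     (\<exists>I J. (\<forall>\<^sub>F \<theta> in at_right 0. has_ray_laplace f \<theta> x I \<and> has_ray_laplace f (- \<theta>) x J) \<and>
            S = (I + J) / 2)"

end

theory Submission
  imports Defs "HOL-Probability.Distributions" "HOL-Real_Asymp.Real_Asymp"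
begin

text \<open>
  The transform is computed term by term. Put \<open>b = n * pi / sqrt 6\<close>, so that the \<open>n\<close>-th summand of
  \<^const>\<open>G\<close> is a multiple of \<open>(b\<^sup>2 - p) powr (-5/2)\<close>. Two integrations by parts bring the exponent to
  \<open>-1/2\<close>, and the substitution \<open>p = b\<^sup>2 - s\<^sup>2\<close> turns the remaining integral of
  \<open>exp (- p * x) / sqrt (b\<^sup>2 - p)\<close> into one of \<open>exp (x * s\<^sup>2)\<close>. Hence
  \<open>exp (- p * x) * (b\<^sup>2 - p) powr (-5/2)\<close> has an explicit primitive in terms of \<^const>\<open>Erfi\<close>
  (\<open>laplace_primitive\<close>), and its integral over a ray is the difference of two boundary values. The
  value at \<open>p = 0\<close> gives the \<^const>\<open>calE\<close> term and an algebraic term. At the other end the argument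
  \<open>csqrt x * csqrt (b\<^sup>2 - p)\<close> of \<^const>\<open>Erfi\<close> leaves through the sector around the negative imaginary
  axis if the ray lies above the real axis, and through the one around the positive imaginary axis
  if it lies below. There \<^const>\<open>Erfi\<close> tends to \<open>-\<i>\<close> and \<open>\<i>\<close> (\<open>Erfi_ray_limit\<close>). So the boundary value
  at infinity depends on the ray only through a sign, and the median removes it
  (\<open>ray_laplace_term\<close>).

  Summation and integration may be exchanged because a ray of angle \<open>\<theta>\<close> stays at distance at least
  \<open>b\<^sup>2 * \<bar>sin \<theta>\<bar>\<close> from the singularity \<open>b\<^sup>2\<close>: the \<open>n\<close>-th summand is at most a constant times
  \<open>exp (- \<kappa> * r) / n ^ 4\<close> with \<open>\<kappa> > 0\<close>, which is dominated convergence (\<open>ray_laplace_G\<close>). This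
  also yields the convergence of both lateral series, hence of their average.

  The algebraic terms of the average add up to \<open>- (6 * sqrt 3 / pi\<^sup>2) * L(2, \<chi>)\<close>. This is the
  constant \<open>-1\<close>, because \<open>L(2, \<chi>) = pi\<^sup>2 / (6 * sqrt 3)\<close> (\<open>chi12_L2\<close>). The latter value follows
  from the reflection formula of the trigamma function, since \<open>\<chi>\<close> is even.
\<close>

section \<open>The imaginary error function\<close>

text \<open>
  The integrand is entire, so it has a primitive on the whole plane, and the integral over the
  segment is a difference of values of that primitive.
\<close>

lemma has_field_derivative_Erfi:
  "(Erfi has_field_derivative 2 / of_real (sqrt pi) * exp (z ^ 2)) (at z)"
proof -
  have "(\<lambda>t::complex. exp (t ^ 2)) holomorphic_on UNIV"
    by (intro holomorphic_intros)
  then obtain g where g: "\<And>z::complex. (g has_field_derivative exp (z ^ 2)) (at z)"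
    using holomorphic_convex_primitive'[of UNIV "\<lambda>t. exp (t ^ 2)"] by auto
  have "contour_integral (linepath 0 z) (\<lambda>t. exp (t ^ 2)) = g z - g 0" for z
    using contour_integral_unique contour_integral_primitive[of UNIV g "\<lambda>t. exp (t ^ 2)"
          "linepath 0 z"] g by auto
  then have eq: "Erfi = (\<lambda>z. 2 / of_real (sqrt pi) * (g z - g 0))"
    by (intro ext) (simp add: Erfi_def)
  show ?thesis
    unfolding eq by (auto intro!: derivative_eq_intros g)
qed

lemmas has_field_derivative_Erfi' [derivative_intros] =
  DERIV_chain2[OF has_field_derivative_Erfi]

lemma Erfi_0 [simp]: "Erfi 0 = 0"
  by (simp add: Erfi_def)

lemma Erfi_minus: "Erfi (- z) = - Erfi z"
proof -
  have "((\<lambda>w. Erfi (- w) + Erfi w) has_field_derivative 0) (at z)" for z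
    by (auto intro!: derivative_eq_intros)
  then obtain c where "\<And>w. Erfi (- w) + Erfi w = c"
    using has_field_derivative_zero_constant[of UNIV "\<lambda>w. Erfi (- w) + Erfi w"] by auto
  from this[of z] this[of 0] show ?thesis
    by (simp add: add_eq_0_iff2)
qed

text \<open>
  On the imaginary axis \<open>Erfi (\<i> * u) = \<i> * erf u\<close>, so the limit is the Gaussian integral over the
  half line.
\<close>

lemma Erfi_imaginary_axis_limit: "((\<lambda>u::real. Erfi (\<i> * of_real u)) \<longlongrightarrow> \<i>) at_top"
proof -
  define f :: "real \<Rightarrow> complex" where "f = (\<lambda>t. of_real (indicator {0..} t *\<^sub>R exp (- t\<^sup>2)))"
  have f: "has_bochner_integral lborel f (of_real (sqrt pi / 2))"
    unfolding f_def using gaussian_moment_0 by (rule has_bochner_integral_of_real)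
  have "((\<lambda>y. \<integral>t. indicator {..y} t *\<^sub>R f t \<partial>lborel) \<longlongrightarrow> (\<integral>t. f t \<partial>lborel)) at_top"
    by (rule tendsto_integral_at_top) (use f in \<open>auto simp: has_bochner_integral_iff\<close>)
  also have "(\<integral>t. f t \<partial>lborel) = of_real (sqrt pi / 2)"
    using f by (simp add: has_bochner_integral_iff)
  finally have lim: "((\<lambda>y. \<integral>t. indicator {..y} t *\<^sub>R f t \<partial>lborel) \<longlongrightarrow> of_real (sqrt pi / 2)) at_top" .
  have eq: "2 * \<i> / of_real (sqrt pi) * (\<integral>t. indicator {..y} t *\<^sub>R f t \<partial>lborel) = Erfi (\<i> * of_real y)"
    if "y \<ge> 0" for y
  proof -
    have "(\<integral>t. indicator {..y} t *\<^sub>R f t \<partial>lborel)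
        = (\<integral>t. indicator {0..y} t *\<^sub>R complex_of_real (exp (- t\<^sup>2)) \<partial>lborel)"
      by (intro Bochner_Integration.integral_cong) (auto simp: f_def indicator_def)
    also have "\<dots> = of_real (sqrt pi) / (2 * \<i>) * Erfi (\<i> * of_real y)
                    - of_real (sqrt pi) / (2 * \<i>) * Erfi (\<i> * of_real 0)"
    proof (rule integral_FTC_Icc)
      fix t :: real
      have "((\<lambda>z. of_real (sqrt pi) / (2 * \<i>) * Erfi (\<i> * z))
              has_field_derivative of_real (exp (- t\<^sup>2))) (at (of_real t))"
        by (auto intro!: derivative_eq_intros simp: field_simps simp flip: exp_of_real)
      then show "((\<lambda>t. of_real (sqrt pi) / (2 * \<i>) * Erfi (\<i> * of_real t))
              has_vector_derivative of_real (exp (- t\<^sup>2))) (at t within {0..y})"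
        by (rule has_vector_derivative_real_field)
    qed (use that in \<open>auto intro!: continuous_intros\<close>)
    finally show ?thesis by simp
  qed
  have "((\<lambda>y. 2 * \<i> / of_real (sqrt pi) * (\<integral>t. indicator {..y} t *\<^sub>R f t \<partial>lborel))
          \<longlongrightarrow> 2 * \<i> / of_real (sqrt pi) * of_real (sqrt pi / 2)) at_top"
    by (intro tendsto_intros lim)
  moreover have "\<forall>\<^sub>F y in at_top. 2 * \<i> / of_real (sqrt pi) * (\<integral>t. indicator {..y} t *\<^sub>R f t \<partial>lborel)
          = Erfi (\<i> * of_real y)"
    using eventually_ge_at_top[of 0] by eventually_elim (rule eq)
  ultimately show ?thesis
    by (auto intro: Lim_transform_eventually)
qed

text \<open>
  On the segment from \<open>Re z\<close> to \<open>z\<close> the real part is constant and the imaginary part is at most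
  that of \<open>z\<close> in modulus. So \<open>Re (w\<^sup>2)\<close> is smallest at the end \<open>w = z\<close>, where the derivative of
  \<open>Erfi (\<i> * w)\<close> has its largest modulus.
\<close>

lemma norm_Erfi_diff_projection_le:
  "norm (Erfi (\<i> * z) - Erfi (\<i> * of_real (Re z)))
     \<le> 2 / sqrt pi * exp (- Re (z ^ 2)) * \<bar>Im z\<bar>"
proof -
  let ?f' = "\<lambda>w. 2 / of_real (sqrt pi) * exp ((\<i> * w) ^ 2) * \<i>"
  have "norm (Erfi (\<i> * z) - Erfi (\<i> * of_real (Re z)))
          \<le> (2 / sqrt pi * exp (- Re (z ^ 2))) * norm (z - of_real (Re z))"
  proof (rule field_differentiable_bound[where f = "\<lambda>w. Erfi (\<i> * w)" and f' = ?f'])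
    fix w assume "w \<in> closed_segment (of_real (Re z)) z"
    then obtain u where u: "0 \<le> u" "u \<le> 1" "w = (1 - u) *\<^sub>R of_real (Re z) + u *\<^sub>R z"
      by (auto simp: in_segment)
    have "(u * Im z) ^ 2 \<le> (Im z)^2"
      using u by (simp add: power_mult_distrib mult_left_le_one_le power_le_one)
    moreover have "Re w = Re z" "Im w = u * Im z"
      by (auto simp: u(3) algebra_simps)
    ultimately have "Re (z ^ 2) \<le> Re (w ^ 2)"
      by (simp add: Re_power2)
    then show "norm (?f' w) \<le> 2 / sqrt pi * exp (- Re (z ^ 2))"
      by (auto simp: norm_mult norm_divide divide_right_mono power_mult_distrib)
  qed (auto intro!: derivative_eq_intros)
  also have "norm (z - of_real (Re z)) = \<bar>Im z\<bar>"
    by (simp add: cmod_def)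
  finally show ?thesis .
qed

text \<open>
  Moving \<open>z\<close> vertically to the real axis changes \<open>Erfi (\<i> * z)\<close> by at most the quantity that is
  assumed to vanish, and the limit along the real axis is known.
\<close>

lemma Erfi_sector_limit:
  assumes Re_pos: "\<forall>\<^sub>F r in F. Re (z r) > 0"
    and Re_sq: "filterlim (\<lambda>r. Re (z r ^ 2)) at_top F"
    and decay: "((\<lambda>r. Im (z r) * exp (- Re (z r ^ 2))) \<longlongrightarrow> 0) F"
  shows "((\<lambda>r. Erfi (\<i> * z r)) \<longlongrightarrow> \<i>) F"
proof -
  have "filterlim (\<lambda>r. Re (z r)) at_top F"
  proof (rule filterlim_at_top_mono)
    show "filterlim (\<lambda>r. sqrt (Re (z r ^ 2))) at_top F"
      by (rule filterlim_compose[OF sqrt_at_top Re_sq])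
    show "\<forall>\<^sub>F r in F. sqrt (Re (z r ^ 2)) \<le> Re (z r)"
      using Re_pos by eventually_elim (auto intro!: real_le_lsqrt simp: Re_power2)
  qed
  then have "((\<lambda>r. Erfi (\<i> * of_real (Re (z r)))) \<longlongrightarrow> \<i>) F"
    by (rule filterlim_compose[OF Erfi_imaginary_axis_limit])
  moreover have "((\<lambda>r. Erfi (\<i> * z r) - Erfi (\<i> * of_real (Re (z r)))) \<longlongrightarrow> 0) F"
  proof (rule Lim_null_comparison)
    show "\<forall>\<^sub>F r in F. norm (Erfi (\<i> * z r) - Erfi (\<i> * of_real (Re (z r))))
            \<le> 2 / sqrt pi * \<bar>Im (z r) * exp (- Re (z r ^ 2))\<bar>"
      using norm_Erfi_diff_projection_le[of "z r" for r] by (intro always_eventually allI)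
            (simp add: abs_mult mult_ac)
    show "((\<lambda>r. 2 / sqrt pi * \<bar>Im (z r) * exp (- Re (z r ^ 2))\<bar>) \<longlongrightarrow> 0) F"
      by (intro tendsto_mult_right_zero tendsto_rabs_zero decay)
  qed
  ultimately show ?thesis
    using tendsto_add by fastforce
qed

section \<open>The value at 2 of the L-function of the character of conductor 12\<close>

lemma pos_not_in_nonpos_Ints: "0 < (x::real) \<Longrightarrow> x \<notin> \<int>\<^sub>\<le>\<^sub>0"
  using nonpos_Ints_nonpos by fastforce

text \<open>
  The logarithmic derivative of the reflection formula of the Gamma function, obtained by
  differentiating the constant function \<open>Gamma t * Gamma (1 - t) * sin (pi * t)\<close>.
\<close>

lemma Digamma_reflection:
  fixes x :: real
  assumes "0 < x" "x < 1"
  shows "Digamma x - Digamma (1 - x) = - pi * cos (pi * x) / sin (pi * x)"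
proof -
  have refl: "Gamma t * Gamma (1 - t) * sin (pi * t) = pi" if "0 < t" "t < 1" for t :: real
  proof -
    have "complex_of_real (Gamma t * Gamma (1 - t)) = of_real (pi / sin (pi * t))"
      using Gamma_reflection_complex[of "of_real t"]
      by (simp flip: Gamma_complex_of_real sin_of_real)
    then have "Gamma t * Gamma (1 - t) = pi / sin (pi * t)"
      by (simp only: of_real_eq_iff)
    moreover have "sin (pi * t) > 0"
      using that by (intro sin_gt_zero) (auto simp: mult_less_cancel_left1)
    ultimately show ?thesis by simp
  qed
  have s: "sin (pi * x) > 0"
    using assms by (intro sin_gt_zero) (auto simp: mult_less_cancel_left1)
  have "((\<lambda>t. Gamma t * Gamma (1 - t) * sin (pi * t)) has_real_derivative
          Gamma x * Gamma (1 - x) * ((Digamma x - Digamma (1 - x)) * sin (pi * x) + pi * cos (pi * x)))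
          (at x)"
    using assms by (auto intro!: derivative_eq_intros pos_not_in_nonpos_Ints simp: algebra_simps)
  moreover have "((\<lambda>t. Gamma t * Gamma (1 - t) * sin (pi * t)) has_real_derivative 0) (at x)"
  proof (rule has_field_derivative_transform_within_open[where S = "{0<..<1}" and f = "\<lambda>_. pi"])
    show "pi = Gamma t * Gamma (1 - t) * sin (pi * t)" if "t \<in> {0<..<1}" for t
      using refl[of t] that by auto
  qed (use assms in auto)
  ultimately have "Gamma x * Gamma (1 - x) *
      ((Digamma x - Digamma (1 - x)) * sin (pi * x) + pi * cos (pi * x)) = 0"
    by (rule DERIV_unique)
  moreover have "Gamma x * Gamma (1 - x) \<noteq> 0"
    using refl[of x] assms by auto
  ultimately have "(Digamma x - Digamma (1 - x)) * sin (pi * x) + pi * cos (pi * x) = 0"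
    by simp
  then show ?thesis
    using s by (simp add: field_simps)
qed

lemma Trigamma_reflection:
  fixes x :: real
  assumes "0 < x" "x < 1"
  shows "Polygamma 1 x + Polygamma 1 (1 - x) = pi ^ 2 / sin (pi * x) ^ 2"
proof -
  have s: "sin (pi * x) > 0"
    using assms by (intro sin_gt_zero) (auto simp: mult_less_cancel_left1)
  have "((\<lambda>t. Digamma t - Digamma (1 - t)) has_real_derivative
          Polygamma 1 x + Polygamma 1 (1 - x)) (at x)"
    using assms by (auto intro!: derivative_eq_intros pos_not_in_nonpos_Ints)
  moreover have "((\<lambda>t. Digamma t - Digamma (1 - t)) has_real_derivative
          pi ^ 2 / sin (pi * x) ^ 2) (at x)"
  proof (rule has_field_derivative_transform_within_open
          [where S = "{0<..<1}" and f = "\<lambda>t. - pi * cos (pi * t) / sin (pi * t)"])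
    have "(sin (pi * x))\<^sup>2 + (cos (pi * x))\<^sup>2 = 1" by simp
    then have "pi ^ 2 / sin (pi * x) ^ 2
        = (pi * pi * sin (pi * x) ^ 2 + pi * pi * cos (pi * x) ^ 2) / sin (pi * x) ^ 2"
      by (simp add: power2_eq_square flip: distrib_left)
    then show "((\<lambda>t. - pi * cos (pi * t) / sin (pi * t)) has_real_derivative
            pi ^ 2 / sin (pi * x) ^ 2) (at x)"
      using s by (auto intro!: derivative_eq_intros
            simp: power2_eq_square algebra_simps add_divide_distrib diff_divide_distrib)
    show "- pi * cos (pi * t) / sin (pi * t) = Digamma t - Digamma (1 - t)"
      if "t \<in> {0<..<1}" for t
      using Digamma_reflection[of t] that by auto
  qed (use assms in auto)
  ultimately show ?thesis
    by (rule DERIV_unique)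
qed

lemma sin_squared_pi_twelfth: "sin (pi / 12) ^ 2 = (2 - sqrt 3) / 4"
  and sin_squared_five_pi_twelfths: "sin (5 * pi / 12) ^ 2 = (2 + sqrt 3) / 4"
proof -
  have "cos (2 * (pi / 12)) = 1 - 2 * sin (pi / 12) ^ 2"
    by (rule cos_double_sin)
  moreover have "2 * (pi / 12) = pi / 6" by simp
  ultimately show "sin (pi / 12) ^ 2 = (2 - sqrt 3) / 4"
    by (simp add: cos_30)
  have "cos (2 * (5 * pi / 12)) = 1 - 2 * sin (5 * pi / 12) ^ 2"
    by (rule cos_double_sin)
  moreover have "2 * (5 * pi / 12) = pi - pi / 6" by simp
  ultimately show "sin (5 * pi / 12) ^ 2 = (2 + sqrt 3) / 4"
    by (simp only: cos_pi_minus cos_30) simp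
qed

text \<open>
  In each block of twelve consecutive integers the character picks the residues \<open>1, 11\<close> with sign
  plus and \<open>5, 7\<close> with sign minus. The sum over each residue class \<open>m\<close> is a trigamma value at
  \<open>m / 12\<close>, and the classes \<open>m\<close> and \<open>12 - m\<close> have the same sign, so that the reflection formula
  evaluates their sum.
\<close>

lemma chi12_L2: "(\<lambda>n. chi12 (Suc n) / of_nat (Suc n) ^ 2) sums of_real (pi ^ 2 / (6 * sqrt 3))"
proof -
  define f :: "nat \<Rightarrow> real" where "f = (\<lambda>n. Re (chi12 n) / real n ^ 2)"
  have f_chi: "complex_of_real (f n) = chi12 n / of_nat n ^ 2" for n
    by (auto simp: f_def chi12_def)
  have summ: "summable f"
  proof (rule summable_comparison_test')
    show "summable (\<lambda>n. 1 / real n ^ 2)"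
      using inverse_power_summable[of 2, where ?'a = real] by (simp add: inverse_eq_divide)
    show "norm (f n) \<le> 1 / real n ^ 2" for n
      by (auto simp: f_def chi12_def)
  qed
  have sin1: "sin (pi * (1/12)) ^ 2 = (2 - sqrt 3) / 4" "sin (pi * (5/12)) ^ 2 = (2 + sqrt 3) / 4"
    using sin_squared_pi_twelfth sin_squared_five_pi_twelfths by (simp_all add: mult.commute)
  have poly: "(\<lambda>k. inverse ((x + real k) ^ 2)) sums Polygamma 1 x" if "x > 0" for x :: real
    using Polygamma_LIMSEQ[of x 1] that by (simp add: numeral_2_eq_2)
  have "(\<lambda>k. 1 / 144 * ((inverse ((1/12 + real k) ^ 2) + inverse ((11/12 + real k) ^ 2))
              - (inverse ((5/12 + real k) ^ 2) + inverse ((7/12 + real k) ^ 2))))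
        sums (1 / 144 * ((Polygamma 1 (1/12) + Polygamma 1 (11/12))
              - (Polygamma 1 (5/12) + Polygamma 1 (7/12))))"
    by (intro sums_mult sums_diff sums_add poly) auto
  also have "(1 / 144 * ((Polygamma 1 (1/12) + Polygamma 1 (11/12))
              - (Polygamma 1 (5/12) + Polygamma 1 (7/12)))) = pi ^ 2 / (6 * sqrt 3)"
  proof -
    have ne: "2 - sqrt 3 \<noteq> 0" "2 + sqrt 3 \<noteq> 0"
      using real_sqrt_less_iff[of 3 4] by (simp_all add: add_pos_pos less_imp_neq[symmetric])
    have "(2 - sqrt 3) * (2 + sqrt 3) = 1" by (simp add: algebra_simps)
    then have inv: "1 / (2 - sqrt 3) = 2 + sqrt 3" "1 / (2 + sqrt 3) = 2 - sqrt 3"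
      using ne by (metis nonzero_divide_eq_eq mult.commute)+
    have "4 * pi\<^sup>2 / (2 - sqrt 3) - 4 * pi\<^sup>2 / (2 + sqrt 3)
        = 4 * pi\<^sup>2 * (1 / (2 - sqrt 3)) - 4 * pi\<^sup>2 * (1 / (2 + sqrt 3))"
      by simp
    also have "\<dots> = 4 * pi\<^sup>2 * (2 * sqrt 3)"
      by (simp only: inv) (simp add: algebra_simps)
    finally have "4 * pi\<^sup>2 / (2 - sqrt 3) - 4 * pi\<^sup>2 / (2 + sqrt 3) = 4 * pi\<^sup>2 * (2 * sqrt 3)" .
    moreover have "Polygamma 1 (1/12) + Polygamma 1 (11/12) = 4 * pi\<^sup>2 / (2 - sqrt 3)"
      using Trigamma_reflection[of "1/12"] unfolding sin1 by simp
    moreover have "Polygamma 1 (5/12) + Polygamma 1 (7/12) = 4 * pi\<^sup>2 / (2 + sqrt 3)"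
      using Trigamma_reflection[of "5/12"] unfolding sin1 by simp
    moreover have "pi\<^sup>2 / (6 * sqrt 3) = pi ^ 2 * sqrt 3 / 18"
      by (simp add: divide_simps)
    ultimately show ?thesis
      by simp
  qed
  also have "(\<lambda>k. 1 / 144 * ((inverse ((1/12 + real k) ^ 2) + inverse ((11/12 + real k) ^ 2))
              - (inverse ((5/12 + real k) ^ 2) + inverse ((7/12 + real k) ^ 2))))
             = (\<lambda>k. sum f {k * 12..<k * 12 + 12})"
  proof
    fix k :: nat
    have r: "1 / 144 * inverse ((m / 12 + real k) ^ 2) = 1 / (real k * 12 + m) ^ 2" if "m > 0"
          for m :: real
    proof -
      have "(real k * 12 + m) ^ 2 = 144 * (m / 12 + real k) ^ 2"
        by (simp add: power2_eq_square algebra_simps)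
      then show ?thesis
        by (simp add: inverse_eq_divide)
    qed
    have m: "(k * 12 + j) mod 12 = j mod 12" for j
      by simp
    have "{k * 12..<k * 12 + 12} = (\<lambda>j. k * 12 + j) ` {0..<12}"
      by (simp add: add.commute)
    then have "sum f {k * 12..<k * 12 + 12} = (\<Sum>j\<in>{0..<12}. f (k * 12 + j))"
      by (simp only: sum.reindex[OF inj_on_add] o_def)
    also have "{0..<12::nat} = {0,1,2,3,4,5,6,7,8,9,10,11}"
      by auto presburger
    also have "(\<Sum>j\<in>\<dots>. f (k * 12 + j)) = 1 / (real k * 12 + 1) ^ 2 - 1 / (real k * 12 + 5) ^ 2
                 - 1 / (real k * 12 + 7) ^ 2 + 1 / (real k * 12 + 11) ^ 2"
      unfolding f_def chi12_def m by simp
    finally show "1 / 144 * ((inverse ((1/12 + real k) ^ 2) + inverse ((11/12 + real k) ^ 2))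
              - (inverse ((5/12 + real k) ^ 2) + inverse ((7/12 + real k) ^ 2)))
             = sum f {k * 12..<k * 12 + 12}"
      using r[of 1] r[of 5] r[of 7] r[of 11] by (simp add: algebra_simps)
  qed
  finally have "(\<lambda>k. sum f {k * 12..<k * 12 + 12}) sums (pi ^ 2 / (6 * sqrt 3))" .
  with sums_group[OF summable_sums[OF summ], of 12] have "suminf f = pi ^ 2 / (6 * sqrt 3)"
    by (simp add: sums_iff)
  with summ have "f sums (pi ^ 2 / (6 * sqrt 3))"
    by (simp add: sums_iff)
  then have "(\<lambda>n. complex_of_real (f n)) sums of_real (pi ^ 2 / (6 * sqrt 3))"
    by (subst sums_of_real_iff)
  then have "(\<lambda>n. complex_of_real (f (Suc n))) sums of_real (pi ^ 2 / (6 * sqrt 3))"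
    by (subst sums_Suc_iff) (simp add: f_def chi12_def)
  then show ?thesis
    by (simp only: f_chi)
qed

section \<open>Laplace transform of one summand along a ray\<close>

lemma powr_five_halves: "z powr (5/2) = csqrt z ^ 5" for z :: complex
proof (cases "z = 0")
  case False
  then show ?thesis
    by (simp add: powr_def csqrt_exp_Ln flip: exp_of_nat_mult)
qed simp

text \<open>
  The right-hand side is at least the distance of \<open>a\<close> to the line that carries the ray; rotating
  this line to the real axis turns the distance into an imaginary part.
\<close>

lemma dist_real_ray_ge:
  fixes a r \<theta> :: real
  assumes "a \<ge> 0"
  shows "a * \<bar>sin \<theta>\<bar> \<le> norm (of_real a - of_real r * cis \<theta>)"
proof -
  have "a * \<bar>sin \<theta>\<bar> = \<bar>Im ((of_real a - of_real r * cis \<theta>) * cis (- \<theta>))\<bar>"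
    using assms by (simp add: abs_mult algebra_simps)
  also have "\<dots> \<le> norm ((of_real a - of_real r * cis \<theta>) * cis (- \<theta>))"
    by (rule abs_Im_le_cmod)
  finally show ?thesis
    by (simp add: norm_mult)
qed

lemma norm_ray_integrand_le:
  fixes b r \<theta> :: real and x :: complex
  assumes "b > 0" "sin \<theta> \<noteq> 0"
  shows "norm (exp (- (of_real r * cis \<theta>) * x) / (of_real (b ^ 2) - of_real r * cis \<theta>) powr (5/2)
        * cis \<theta>)
           \<le> exp (- Re (x * cis \<theta>) * r) / (b ^ 5 * \<bar>sin \<theta>\<bar> powr (5/2))"
proof -
  let ?q = "of_real (b ^ 2) - of_real r * cis \<theta> :: complex"
  have "b ^ 5 * \<bar>sin \<theta>\<bar> powr (5/2) = (b ^ 2 * \<bar>sin \<theta>\<bar>) powr (5/2)"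
    using assms by (simp add: powr_mult powr_powr flip: powr_numeral)
  also have "\<dots> \<le> norm ?q powr (5/2)"
    using dist_real_ray_ge[of "b ^ 2" \<theta> r] by (intro powr_mono2) auto
  also have "\<dots> = norm (?q powr (5/2))"
    by (subst norm_powr_real_powr') auto
  finally have le: "b ^ 5 * \<bar>sin \<theta>\<bar> powr (5/2) \<le> norm (?q powr (5/2))" .
  have "1 / norm (?q powr (5/2)) \<le> 1 / (b ^ 5 * \<bar>sin \<theta>\<bar> powr (5/2))"
    using assms by (intro frac_le le) auto
  then have "exp (- Re (x * cis \<theta>) * r) * (1 / norm (?q powr (5/2)))
      \<le> exp (- Re (x * cis \<theta>) * r) * (1 / (b ^ 5 * \<bar>sin \<theta>\<bar> powr (5/2)))"
    by (intro mult_left_mono) auto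
  moreover have "norm (exp (- (of_real r * cis \<theta>) * x)) = exp (- Re (x * cis \<theta>) * r)"
    by (simp add: algebra_simps)
  ultimately show ?thesis
    by (simp add: norm_mult norm_divide)
qed

text \<open>
  The outcome of integrating \<open>exp (- p * x) * s ^ (-5)\<close> by parts twice, where \<open>s = csqrt (a - p)\<close>:
  the first summand collects the boundary terms. The second one is the primitive of
  \<open>(4 * x\<^sup>2 / 3) * exp (- p * x) / s\<close> given by \<open>p = a - s\<^sup>2\<close>. The parameter \<open>c\<close> is a square root
  of \<open>x\<close>, so that \<open>(c * s)\<^sup>2 = x * (a - p)\<close>.
\<close>

lemma laplace_primitive:
  fixes a x c p :: complex
  assumes c: "c ^ 2 = x" "c \<noteq> 0" and q: "a - p \<notin> \<real>\<^sub>\<le>\<^sub>0"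
  shows "((\<lambda>p. exp (- p * x) * (2 / (3 * csqrt (a - p) ^ 3) + 4 * x / (3 * csqrt (a - p)))
             - 4 / 3 * of_real (sqrt pi) * c ^ 3 * exp (- a * x) * Erfi (c * csqrt (a - p)))
          has_field_derivative exp (- p * x) / (a - p) powr (5/2)) (at p)"
proof -
  define s where "s = csqrt (a - p)"
  have s: "s \<noteq> 0" "s ^ 2 = a - p"
    using q by (auto simp: s_def)
  have pi: "complex_of_real (sqrt pi) \<noteq> 0" by simp
  have D: "((\<lambda>p. exp (- p * x) * (2 / (3 * csqrt (a - p) ^ 3) + 4 * x / (3 * csqrt (a - p)))
             - 4 / 3 * of_real (sqrt pi) * c ^ 3 * exp (- a * x) * Erfi (c * csqrt (a - p)))
          has_field_derivative
            - x * exp (- p * x) * (2 / (3 * s ^ 3) + 4 * x / (3 * s))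
            + exp (- p * x) * (1 / s ^ 5 + 2 * x / (3 * s ^ 3))
            - 4 / 3 * of_real (sqrt pi) * c ^ 3 * exp (- a * x)
                * (2 / of_real (sqrt pi) * exp ((c * s) ^ 2) * (c * (- 1 / (2 * s))))) (at p)"
    using q s(1) unfolding s_def
    by (auto intro!: derivative_eq_intros simp: field_simps power_numeral_reduce)
  have "- a * x + (c * s) ^ 2 = - p * x"
    by (simp only: power_mult_distrib c(1) s(2)) (simp add: algebra_simps)
  then have "exp (- a * x) * exp ((c * s) ^ 2) = exp (- p * x)"
    by (simp only: flip: exp_add)
  moreover have "c ^ 3 * c = x ^ 2"
    by (simp add: c(1)[symmetric] power_numeral_reduce)
  moreover have "4 / 3 * of_real (sqrt pi) * c ^ 3 * exp (- a * x)
          * (2 / of_real (sqrt pi) * exp ((c * s) ^ 2) * (c * (- 1 / (2 * s))))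
        = - (4 / (3 * s)) * (c ^ 3 * c) * (exp (- a * x) * exp ((c * s) ^ 2))"
    using pi s(1) by (simp add: field_simps)
  ultimately have last: "4 / 3 * of_real (sqrt pi) * c ^ 3 * exp (- a * x)
          * (2 / of_real (sqrt pi) * exp ((c * s) ^ 2) * (c * (- 1 / (2 * s))))
        = - (4 / (3 * s)) * x ^ 2 * exp (- p * x)"
    by metis
  have "- x * exp (- p * x) * (2 / (3 * s ^ 3) + 4 * x / (3 * s))
            + exp (- p * x) * (1 / s ^ 5 + 2 * x / (3 * s ^ 3))
            - - (4 / (3 * s)) * x ^ 2 * exp (- p * x) = exp (- p * x) / s ^ 5"
    by (simp add: algebra_simps power2_eq_square)
  with D last show ?thesis
    by (simp only: powr_five_halves s_def)
qed

text \<open>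
  Write \<open>w = csqrt x * csqrt (a - p)\<close> with \<open>p = r * cis \<theta>\<close>. Since \<open>- w\<^sup>2 = x * (p - a)\<close> has a real
  part that grows linearly in \<open>r\<close>, one of \<open>\<i> * w\<close> and \<open>- \<i> * w\<close> tends to infinity inside the
  sector where \<open>Erfi_sector_limit\<close> applies. The sign of \<open>sin \<theta>\<close> decides which one:
  \<open>Im (csqrt (a - p))\<close> has the opposite sign, and multiplication by \<open>csqrt x\<close>, whose argument is
  less than \<open>pi / 4\<close> in modulus, does not carry such a \<open>w\<close> across the real axis.
\<close>

lemma Erfi_ray_limit:
  fixes a \<theta> :: real and x :: complex
  assumes x: "Re x > 0" "Re (x * cis \<theta>) > 0" and \<theta>: "sin \<theta> \<noteq> 0" and a: "a \<ge> 0"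
  shows "((\<lambda>r. Erfi (csqrt x * csqrt (of_real a - of_real r * cis \<theta>)))
           \<longlongrightarrow> - of_real (sgn (sin \<theta>)) * \<i>) at_top"
proof -
  define c where "c = csqrt x"
  define \<sigma> where "\<sigma> = sgn (sin \<theta>)"
  define s where "s = (\<lambda>r::real. csqrt (of_real a - of_real r * cis \<theta>))"
  define z where "z = (\<lambda>r. of_real \<sigma> * \<i> * (c * s r))"
  define k where "k = Re (x * cis \<theta>)"
  have \<sigma>: "\<sigma> = 1 \<or> \<sigma> = - 1" "\<sigma> * \<sigma> = 1" "\<sigma> * sin \<theta> > 0"
    using \<theta> by (auto simp: \<sigma>_def sgn_if)
  have k: "k > 0" using x by (simp add: k_def)
  have c2: "c ^ 2 = x" by (simp add: c_def)
  have c: "Re c > \<bar>Im c\<bar>"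
  proof -
    have "(Im c)\<^sup>2 < (Re c)\<^sup>2"
      using x(1) c2 by (auto simp: Re_power2)
    moreover have "Re c \<ge> 0" unfolding c_def by (rule Re_csqrt)
    ultimately show ?thesis
      by (metis abs_of_nonneg power2_abs power_less_imp_less_base)
  qed
  have z2: "z r ^ 2 = x * (of_real r * cis \<theta> - of_real a)" for r
  proof -
    have "(of_real \<sigma>) ^ 2 = (1 :: complex)"
      using \<sigma>(2) by (simp add: power2_eq_square flip: of_real_mult)
    then have "z r ^ 2 = - (c ^ 2 * s r ^ 2)"
      by (simp add: z_def power_mult_distrib)
    then show ?thesis
      by (simp add: c2 s_def algebra_simps)
  qed
  have Re_z2: "Re (z r ^ 2) = k * r - a * Re x" for r
    unfolding z2 by (simp add: k_def algebra_simps)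
  have lim: "filterlim (\<lambda>r. Re (z r ^ 2)) at_top at_top"
    unfolding Re_z2 using k by real_asymp
  have Re_z: "\<forall>\<^sub>F r in at_top. Re (z r) > 0"
    using eventually_gt_at_top[of 0] filterlim_at_top_dense[THEN iffD1, OF lim, rule_format, of 0]
  proof eventually_elim
    case (elim r)
    \<comment> \<open>If \<open>\<sigma> * Im w \<ge> 0\<close>, then dividing \<open>w\<close> by \<open>c\<close> would give \<open>\<sigma> * Im (s r) \<ge> 0\<close>,
      because \<open>\<bar>Re w\<bar> \<le> \<bar>Im w\<bar>\<close> and \<open>\<bar>Im c\<bar> < Re c\<close>.\<close>
    define w where "w = c * s r"
    have w: "(Re w)\<^sup>2 < (Im w)\<^sup>2"
    proof -
      have "z r ^ 2 = - (w ^ 2)"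
        using \<sigma>(1) by (auto simp: z_def w_def power_mult_distrib)
      with elim show ?thesis by (simp add: Re_power2)
    qed
    have "\<sigma> * Im (s r) < 0"
    proof -
      have "Im (of_real a - of_real r * cis \<theta>) \<noteq> 0"
        using elim \<theta> by auto
      moreover have "2 * Re (s r) * Im (s r) = Im (s r ^ 2)"
        by (simp add: Im_power2)
      moreover have "s r ^ 2 = of_real a - of_real r * cis \<theta>"
        by (simp add: s_def)
      ultimately have eq: "2 * Re (s r) * Im (s r) = - r * sin \<theta>" by simp
      have "Re (s r) * (\<sigma> * Im (s r)) < 0"
      proof -
        have "2 * (Re (s r) * (\<sigma> * Im (s r))) = \<sigma> * (2 * Re (s r) * Im (s r))" by simp
        also have "\<dots> = - r * (\<sigma> * sin \<theta>)" by (simp add: eq)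
        also have "\<dots> < 0" using elim \<sigma>(3) by (simp add: mult_pos_pos)
        finally show ?thesis by linarith
      qed
      moreover have "Re (s r) \<ge> 0" unfolding s_def by (rule Re_csqrt)
      ultimately show ?thesis by (simp add: mult_less_0_iff)
    qed
    \<comment> \<open>The imaginary part of \<open>s r * \<bar>c\<bar>\<^sup>2 = w * cnj c\<close>.\<close>
    moreover have "(\<sigma> * Im (s r)) * (norm c)\<^sup>2 = \<sigma> * Im w * Re c - \<sigma> * Re w * Im c"
      unfolding cmod_power2 by (simp add: w_def power2_eq_square algebra_simps)
    moreover have "(norm c)\<^sup>2 > 0"
      using c by auto
    ultimately have neg: "\<sigma> * Im w * Re c - \<sigma> * Re w * Im c < 0"
      by (metis mult_neg_pos)
    have "\<sigma> * Im w < 0"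
    proof (rule ccontr)
      assume "\<not> \<sigma> * Im w < 0"
      then have "\<sigma> * Im w = \<bar>Im w\<bar>"
        using \<sigma>(1) by auto
      moreover have "\<bar>Re w\<bar> \<le> \<bar>Im w\<bar>"
        using w by (simp add: abs_le_square_iff)
      then have "\<bar>Re w\<bar> * \<bar>Im c\<bar> \<le> \<bar>Im w\<bar> * Re c"
        using c by (intro mult_mono) auto
      moreover have "\<sigma> * Re w * Im c \<le> \<bar>Re w\<bar> * \<bar>Im c\<bar>"
        using \<sigma>(1) abs_ge_self[of "\<sigma> * Re w * Im c"] by (auto simp: abs_mult)
      ultimately show False
        using neg by simp
    qed
    then show ?case
      by (simp add: z_def w_def)
  qed
  have decay: "((\<lambda>r. Im (z r) * exp (- Re (z r ^ 2))) \<longlongrightarrow> 0) at_top"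
  proof (rule Lim_null_comparison)
    show "\<forall>\<^sub>F r in at_top. norm (Im (z r) * exp (- Re (z r ^ 2)))
            \<le> (1 + norm x * (r + a)) * exp (- (k * r - a * Re x))"
      using eventually_ge_at_top[of 0]
    proof eventually_elim
      case (elim r)
      \<comment> \<open>A polynomial bound for \<open>\<bar>z r\<bar>\<close> is enough against the exponential factor.\<close>
      have "norm (z r) \<le> 1 + norm (z r) ^ 2"
        using sum_squares_bound[of 1 "norm (z r)"]
        by (simp add: power2_eq_square) (smt (verit) norm_ge_zero)
      also have "norm (z r) ^ 2 = norm x * norm (of_real r * cis \<theta> - of_real a)"
        by (simp add: z2 norm_mult flip: norm_power)
      also have "norm (of_real r * cis \<theta> - of_real a) \<le> r + a"
        using norm_triangle_ineq4[of "of_real r * cis \<theta>" "of_real a"] elim a by (simp add: norm_mult)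
      finally have "\<bar>Im (z r)\<bar> \<le> 1 + norm x * (r + a)"
        using abs_Im_le_cmod[of "z r"] by (simp add: mult_left_mono)
      then show ?case
        by (simp add: Re_z2 abs_mult mult_right_mono)
    qed
    show "((\<lambda>r. (1 + norm x * (r + a)) * exp (- (k * r - a * Re x))) \<longlongrightarrow> 0) at_top"
      using k by real_asymp
  qed
  have "((\<lambda>r. Erfi (\<i> * z r)) \<longlongrightarrow> \<i>) at_top"
    by (rule Erfi_sector_limit[OF Re_z lim decay])
  then have "((\<lambda>r. - of_real \<sigma> * Erfi (\<i> * z r)) \<longlongrightarrow> - of_real \<sigma> * \<i>) at_top"
    by (intro tendsto_intros)
  moreover have "- of_real \<sigma> * Erfi (\<i> * z r) = Erfi (c * s r)" for r
    using \<sigma>(1) by (auto simp: z_def Erfi_minus)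
  ultimately show ?thesis
    by (simp add: c_def s_def \<sigma>_def)
qed

text \<open>
  The integrals over \<open>[0, k]\<close> are known from the fundamental theorem of calculus, and domination
  by \<open>h\<close> lets \<open>k\<close> tend to infinity.
\<close>

lemma has_integral_ray_to_infinity:
  fixes f F :: "real \<Rightarrow> complex"
  assumes deriv: "\<And>r. r \<ge> 0 \<Longrightarrow> (F has_vector_derivative f r) (at r within {0..})"
    and bound: "\<And>r. r \<ge> 0 \<Longrightarrow> norm (f r) \<le> h r" and h: "h integrable_on {0..}"
    and lim: "(F \<longlongrightarrow> L) at_top"
  shows "(f has_integral (L - F 0)) {0..}"
proof (rule has_integral_dominated_convergence)
  show "((\<lambda>r. if r \<in> {0..real k} then f r else 0) has_integral (F (real k) - F 0)) {0..}" for k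
  proof -
    have "(f has_integral (F (real k) - F 0)) {0..real k}"
      by (rule fundamental_theorem_of_calculus)
         (auto intro: has_vector_derivative_within_subset[OF deriv])
    then show ?thesis
      by (subst has_integral_restrict) auto
  qed
  show "\<forall>r\<in>{0..}. norm (if r \<in> {0..real k} then f r else 0) \<le> h r" for k
    using bound by (auto intro: order_trans[OF norm_ge_zero])
  show "\<forall>r\<in>{0..}. (\<lambda>k. if r \<in> {0..real k} then f r else 0) \<longlonglongrightarrow> f r"
  proof
    fix r :: real assume r: "r \<in> {0..}"
    have "\<forall>\<^sub>F k in sequentially. r \<le> real k"
      using filterlim_real_sequentially by (auto simp: filterlim_at_top)
    then have "\<forall>\<^sub>F k in sequentially. (if r \<in> {0..real k} then f r else 0) = f r"
      by eventually_elim (use r in auto)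
    then show "(\<lambda>k. if r \<in> {0..real k} then f r else 0) \<longlonglongrightarrow> f r"
      by (rule tendsto_eventually)
  qed
  show "(\<lambda>k. F (real k) - F 0) \<longlonglongrightarrow> L - F 0"
    by (intro tendsto_intros filterlim_compose[OF lim filterlim_real_sequentially])
qed (rule h)

text \<open>
  The first summand of the value is minus the primitive at \<open>0\<close>; the second is its limit at infinity,
  which is odd under reflecting the ray in the real axis.
\<close>

lemma ray_laplace_term:
  fixes b \<theta> :: real and x :: complex
  assumes x: "Re x > 0" "Re (x * cis \<theta>) > 0" and \<theta>: "sin \<theta> \<noteq> 0" and b: "b > 0"
  shows "((\<lambda>r. exp (- (of_real r * cis \<theta>) * x) / (of_real (b ^ 2) - of_real r * cis \<theta>) powr (5/2)
        * cis \<theta>)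
          has_integral
            (4 * of_real (sqrt pi) * calE (of_real b * csqrt x) - 2) / (3 * of_real b ^ 3)
            + of_real (sgn (sin \<theta>))
                  * (4 / 3 * \<i> * of_real (sqrt pi) * csqrt x ^ 3 * exp (- of_real (b ^ 2) * x)))
          {0..}"
proof -
  define c where "c = csqrt x"
  define k where "k = Re (x * cis \<theta>)"
  define P where "P = (\<lambda>p. exp (- p * x)
        * (2 / (3 * csqrt (of_real (b ^ 2) - p) ^ 3) + 4 * x / (3 * csqrt (of_real (b ^ 2) - p)))
             - 4 / 3 * of_real (sqrt pi) * c ^ 3 * exp (- of_real (b ^ 2) * x)
                   * Erfi (c * csqrt (of_real (b ^ 2) - p)))"
  define L where "L = of_real (sgn (sin \<theta>))
        * (4 / 3 * \<i> * of_real (sqrt pi) * c ^ 3 * exp (- of_real (b ^ 2) * x))"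
  have k: "k > 0" using x by (simp add: k_def)
  have c: "c ^ 2 = x" "c \<noteq> 0"
    using x by (auto simp: c_def)
  have off_cut: "of_real (b ^ 2) - of_real r * cis \<theta> \<notin> \<real>\<^sub>\<le>\<^sub>0" for r :: real
  proof (cases "r = 0")
    case True
    then show ?thesis using b by (simp del: of_real_power)
  next
    case False
    then show ?thesis
      using \<theta> by (auto simp: complex_nonpos_Reals_iff)
  qed
  have "((\<lambda>r. exp (- (of_real r * cis \<theta>) * x) / (of_real (b ^ 2) - of_real r * cis \<theta>) powr (5/2)
        * cis \<theta>)
          has_integral (L - P (of_real 0 * cis \<theta>))) {0..}"
  proof (rule has_integral_ray_to_infinity)
    fix r :: real
    have "((\<lambda>t. P (t * cis \<theta>)) has_field_derivative
            exp (- (of_real r * cis \<theta>) * x) / (of_real (b ^ 2) - of_real r * cis \<theta>) powr (5/2)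
                  * cis \<theta>) (at (of_real r))"
    proof (rule DERIV_chain2[where f = P and g = "\<lambda>t. t * cis \<theta>"])
      show "(P has_field_derivative exp (- (of_real r * cis \<theta>) * x)
              / (of_real (b ^ 2) - of_real r * cis \<theta>) powr (5/2)) (at (of_real r * cis \<theta>))"
        unfolding P_def by (rule laplace_primitive[OF c off_cut])
    qed (auto intro!: derivative_eq_intros)
    then show "((\<lambda>r. P (of_real r * cis \<theta>)) has_vector_derivative
            exp (- (of_real r * cis \<theta>) * x) / (of_real (b ^ 2) - of_real r * cis \<theta>) powr (5/2)
                  * cis \<theta>) (at r within {0..})"
      by (rule has_vector_derivative_real_field)
    show "norm (exp (- (of_real r * cis \<theta>) * x) / (of_real (b ^ 2) - of_real r * cis \<theta>) powr (5/2)
          * cis \<theta>)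
            \<le> exp (- k * r) / (b ^ 5 * \<bar>sin \<theta>\<bar> powr (5/2))"
      using norm_ray_integrand_le[OF b \<theta>] unfolding k_def .
  next
    show "(\<lambda>r. exp (- k * r) / (b ^ 5 * \<bar>sin \<theta>\<bar> powr (5/2))) integrable_on {0..}"
      using integrable_on_exp_minus_to_infinity[OF k] by (intro integrable_on_divide)
  next
    let ?s = "\<lambda>r. csqrt (of_real (b ^ 2) - of_real r * cis \<theta>)"
    have inv_lim: "((\<lambda>r. inverse (?s r)) \<longlongrightarrow> 0) at_top"
    proof -
      have "filterlim (\<lambda>r. norm (?s r)) at_top at_top"
      proof (rule filterlim_at_top_mono)
        show "filterlim (\<lambda>r. sqrt (r - b ^ 2)) at_top at_top"
          by real_asymp
        show "\<forall>\<^sub>F r in at_top. sqrt (r - b ^ 2) \<le> norm (?s r)"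
          using eventually_ge_at_top[of 0]
        proof eventually_elim
          case (elim r)
          have "r - b ^ 2 \<le> norm (of_real (b ^ 2) - of_real r * cis \<theta>)"
            using norm_triangle_ineq3[of "of_real r * cis \<theta>" "of_real (b ^ 2)"] elim
            by (simp add: norm_mult norm_power norm_minus_commute)
          then show ?case by (simp add: norm_csqrt)
        qed
      qed
      then have "filterlim ?s at_infinity at_top"
        by (rule filterlim_norm_at_top_imp_at_infinity)
      then show ?thesis
        by (rule filterlim_compose[OF tendsto_inverse_0])
    qed
    have exp_lim: "((\<lambda>r. exp (- (of_real r * cis \<theta>) * x)) \<longlongrightarrow> 0) at_top"
    proof (rule tendsto_norm_zero_cancel)
      have "((\<lambda>r. exp (- k * r)) \<longlongrightarrow> 0) at_top"
        using k by real_asymp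
      then show "((\<lambda>r. norm (exp (- (of_real r * cis \<theta>) * x))) \<longlongrightarrow> 0) at_top"
        by (simp add: k_def algebra_simps)
    qed
    have inv_eq: "2 / 3 * inverse w ^ 3 + 4 * x / 3 * inverse w = 2 / (3 * w ^ 3) + 4 * x / (3 * w)"
          for w
      by (cases "w = 0") (simp_all add: field_simps)
    have "((\<lambda>r. exp (- (of_real r * cis \<theta>) * x)
          * (2 / 3 * inverse (?s r) ^ 3 + 4 * x / 3 * inverse (?s r))
             - 4 / 3 * of_real (sqrt pi) * c ^ 3 * exp (- of_real (b ^ 2) * x) * Erfi (c * ?s r))
          \<longlongrightarrow> 0 * (2 / 3 * 0 ^ 3 + 4 * x / 3 * 0)
                - 4 / 3 * of_real (sqrt pi) * c ^ 3 * exp (- of_real (b ^ 2) * x)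
              * (- of_real (sgn (sin \<theta>)) * \<i>)) at_top"
      unfolding c_def
      by (intro tendsto_intros inv_lim exp_lim Erfi_ray_limit x \<theta>) simp
    also have "0 * (2 / 3 * 0 ^ 3 + 4 * x / 3 * 0)
          - 4 / 3 * of_real (sqrt pi) * c ^ 3 * exp (- of_real (b ^ 2) * x)
              * (- of_real (sgn (sin \<theta>)) * \<i>) = L"
      by (simp add: L_def)
    also have "(\<lambda>r. exp (- (of_real r * cis \<theta>) * x)
          * (2 / 3 * inverse (?s r) ^ 3 + 4 * x / 3 * inverse (?s r))
             - 4 / 3 * of_real (sqrt pi) * c ^ 3 * exp (- of_real (b ^ 2) * x) * Erfi (c * ?s r))
             = (\<lambda>r. P (of_real r * cis \<theta>))"
      by (simp only: P_def inv_eq)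
    finally show "((\<lambda>r. P (of_real r * cis \<theta>)) \<longlongrightarrow> L) at_top" .
  qed
  also have "L - P (of_real 0 * cis \<theta>)
        = (4 * of_real (sqrt pi) * calE (of_real b * c) - 2) / (3 * of_real b ^ 3) + L"
  proof -
    have sqrt_b: "csqrt (of_real (b ^ 2) - of_real 0 * cis \<theta>) = of_real b"
      using b csqrt_of_real[of "b ^ 2"] by simp
    have exp_b: "exp (- ((of_real b * c) ^ 2)) = exp (- of_real (b ^ 2) * x)"
      by (simp add: power_mult_distrib c)
    have "L - (1 * (2 / (3 * w ^ 3) + 4 * c ^ 2 / (3 * w)) - 4 / 3 * s * c ^ 3 * e * E)
        = (4 * s * (e * (w * c) ^ 3 * E - (w * c) ^ 2 / s) - 2) / (3 * w ^ 3) + L"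
      if "w \<noteq> 0" "s \<noteq> 0" for w s e E :: complex
      using that by (simp add: field_simps power_numeral_reduce)
    from this[of "of_real b" "of_real (sqrt pi)"] b show ?thesis
      unfolding P_def calE_def sqrt_b exp_b by (simp add: c(1) mult.commute)
  qed
  finally show ?thesis
    unfolding L_def c_def by (simp add: add.commute)
qed

section \<open>The median transform of the series\<close>

definition sqrt_singularity :: "nat \<Rightarrow> real" where
  "sqrt_singularity m = real m * pi / sqrt 6"

lemma sqrt_singularity_pos: "m > 0 \<Longrightarrow> sqrt_singularity m > 0"
  by (simp add: sqrt_singularity_def)

lemma sqrt_singularity_squared: "sqrt_singularity m ^ 2 = real m ^ 2 * pi ^ 2 / 6"
  by (simp add: sqrt_singularity_def power_divide power_mult_distrib)

lemma norm_chi12_le: "norm (chi12 n) \<le> 1"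
  by (simp add: chi12_def)

lemma csqrt_divide_6: "csqrt (x / 6) = csqrt x / of_real (sqrt 6)"
proof (rule csqrt_unique)
  show "(csqrt x / of_real (sqrt 6))\<^sup>2 = x / 6"
    by (simp add: power_divide flip: of_real_power)
  show "0 < Re (csqrt x / of_real (sqrt 6)) \<or>
        Re (csqrt x / of_real (sqrt 6)) = 0 \<and> 0 \<le> Im (csqrt x / of_real (sqrt 6))"
    using csqrt_principal[of x] by (auto simp del: csqrt.simps)
qed

text \<open>
  Dominated convergence for the partial sums. It also gives the convergence of the series of the
  integrals, which is where the summability of the \<^const>\<open>calE\<close> series comes from.
\<close>

lemma ray_laplace_G:
  fixes x :: complex and \<theta> :: real
  assumes x: "Re x > 0" "Re (x * cis \<theta>) > 0" and \<theta>: "sin \<theta> \<noteq> 0"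
  defines "b \<equiv> \<lambda>n. sqrt_singularity (Suc n)"
  defines "C \<equiv> \<lambda>n. of_real (3 * pi / (2 * sqrt 2)) * chi12 (Suc n) * of_nat (Suc n)"
  obtains I where "has_ray_laplace G \<theta> x I"
    "(\<lambda>n. C n * ((4 * of_real (sqrt pi) * calE (of_real (b n) * csqrt x) - 2) / (3 * of_real (b n) ^ 3)
        + of_real (sgn (sin \<theta>)) *
            (4 / 3 * \<i> * of_real (sqrt pi) * csqrt x ^ 3 * exp (- of_real (b n ^ 2) * x)))) sums I"
proof -
  define q where "q = (\<lambda>n r. (of_real (b n ^ 2) - of_real r * cis \<theta>) powr (5/2 :: complex))"
  define t where "t = (\<lambda>n r. exp (- (of_real r * cis \<theta>) * x) / q n r * cis \<theta>)"
  define y where "y = (\<lambda>n. (4 * of_real (sqrt pi) * calE (of_real (b n) * csqrt x) - 2)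
        / (3 * of_real (b n) ^ 3)
        + of_real (sgn (sin \<theta>)) *
            (4 / 3 * \<i> * of_real (sqrt pi) * csqrt x ^ 3 * exp (- of_real (b n ^ 2) * x)))"
  define B where "B = (\<lambda>n. 3 * pi / (2 * sqrt 2) * real (Suc n) / (b n ^ 5 * \<bar>sin \<theta>\<bar> powr (5/2)))"
  define k where "k = Re (x * cis \<theta>)"
  define g where "g = (\<lambda>r. exp (- (of_real r * cis \<theta>) * x) * G (of_real r * cis \<theta>) * cis \<theta>)"
  have b: "b n > 0" for n
    by (simp add: b_def sqrt_singularity_pos)
  have k: "k > 0" using x by (simp add: k_def)
  have t: "(t n has_integral y n) {0..}" for n
    unfolding t_def y_def q_def by (rule ray_laplace_term[OF x \<theta> b])
  have B_nonneg: "B n \<ge> 0" for n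
    using b[of n] by (simp add: B_def less_imp_le)
  have B: "summable B"
  proof -
    have "B = (\<lambda>n. 3 * pi / (2 * sqrt 2) / ((pi / sqrt 6) ^ 5 * \<bar>sin \<theta>\<bar> powr (5/2))
          * (1 / real (Suc n) ^ 4))"
    proof
      fix n
      have "K * m / ((m * d) ^ 5 * S) = K / (d ^ 5 * S) * (1 / m ^ 4)" if "m > 0" for K m d S :: real
        using that by (simp add: power_mult_distrib power_numeral_reduce)
      from this[of "real (Suc n)" "3 * pi / (2 * sqrt 2)" "pi / sqrt 6" "\<bar>sin \<theta>\<bar> powr (5/2)"]
      show "B n = 3 * pi / (2 * sqrt 2) / ((pi / sqrt 6) ^ 5 * \<bar>sin \<theta>\<bar> powr (5/2))
            * (1 / real (Suc n) ^ 4)"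
        by (simp only: B_def b_def sqrt_singularity_def times_divide_eq_right)
    qed
    moreover have "summable (\<lambda>n. 1 / real (Suc n) ^ 4)"
      using inverse_power_summable[of 4, where ?'a = real]
      by (subst summable_Suc_iff) (simp add: inverse_eq_divide)
    ultimately show ?thesis
      by (simp only: summable_mult)
  qed
  have C_le: "norm (C n) \<le> 3 * pi / (2 * sqrt 2) * real (Suc n)" for n
  proof -
    have "norm (C n) = 3 * pi / (2 * sqrt 2) * real (Suc n) * norm (chi12 (Suc n))"
      by (simp add: C_def norm_mult norm_divide del: of_nat_Suc)
    also have "\<dots> \<le> 3 * pi / (2 * sqrt 2) * real (Suc n) * 1"
      by (intro mult_left_mono norm_chi12_le) auto
    finally show ?thesis by simp
  qed
  have term_le: "norm (C n * t n r) \<le> exp (- k * r) * B n" for n r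
  proof -
    have "norm (C n * t n r) \<le> (3 * pi / (2 * sqrt 2) * real (Suc n)) *
            (exp (- k * r) / (b n ^ 5 * \<bar>sin \<theta>\<bar> powr (5/2)))"
      unfolding norm_mult[of "C n"]
      using norm_ray_integrand_le[OF b[of n] \<theta>, where r = r and x = x]
      by (intro mult_mono C_le) (auto simp: t_def q_def k_def)
    then show ?thesis by (simp add: B_def mult_ac)
  qed
  have g_sums: "(\<lambda>n. C n * t n r) sums g r" for r
  proof -
    let ?e = "exp (- (of_real r * cis \<theta>) * x)"
    have "summable (\<lambda>n. C n * t n r)"
      by (rule summable_comparison_test'[OF summable_mult[OF B, of "exp (- k * r)"] term_le])
    then have "summable (\<lambda>n. inverse ?e * inverse (cis \<theta>)
          * inverse (of_real (3 * pi / (2 * sqrt 2))) * (C n * t n r))"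
      by (rule summable_mult)
    also have "(\<lambda>n. inverse ?e * inverse (cis \<theta>) * inverse (of_real (3 * pi / (2 * sqrt 2)))
          * (C n * t n r))
        = (\<lambda>n. chi12 (Suc n) * of_nat (Suc n) / q n r)"
      by (intro ext) (simp add: C_def t_def field_simps del: of_nat_Suc)
    finally have "(\<lambda>n. ?e * cis \<theta> * of_real (3 * pi / (2 * sqrt 2))
          * (chi12 (Suc n) * of_nat (Suc n) / q n r))
        sums (?e * cis \<theta> * of_real (3 * pi / (2 * sqrt 2))
              * (\<Sum>n. chi12 (Suc n) * of_nat (Suc n) / q n r))"
      by (intro sums_mult summable_sums)
    also have "(\<Sum>n. chi12 (Suc n) * of_nat (Suc n) / q n r)
        = (\<Sum>n. chi12 (Suc n) * of_nat (Suc n) /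
            ((- (of_real r * cis \<theta>) + of_real (real (Suc n) ^ 2 * pi ^ 2 / 6)) powr (5/2)))"
      by (simp only: q_def b_def sqrt_singularity_squared) (simp only: diff_conv_add_uminus add.commute)
    also have "?e * cis \<theta> * of_real (3 * pi / (2 * sqrt 2)) * \<dots> = g r"
      by (simp only: g_def G_def mult_ac)
    finally show ?thesis
      by (simp add: C_def t_def mult_ac del: of_nat_Suc)
  qed
  have int: "((\<lambda>r. \<Sum>n<N. C n * t n r) has_integral (\<Sum>n<N. C n * y n)) {0..}" for N
    by (intro has_integral_sum has_integral_mult_right t) auto
  have dom: "norm (\<Sum>n<N. C n * t n r) \<le> exp (- k * r) * suminf B" for N r
  proof -
    have "norm (\<Sum>n<N. C n * t n r) \<le> (\<Sum>n<N. exp (- k * r) * B n)"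
      by (intro order_trans[OF norm_sum] sum_mono term_le)
    also have "\<dots> \<le> exp (- k * r) * suminf B"
      using B B_nonneg by (auto simp flip: sum_distrib_left intro!: mult_left_mono sum_le_suminf)
    finally show ?thesis .
  qed
  have h: "(\<lambda>r. exp (- k * r) * suminf B) integrable_on {0..}"
    using integrable_on_exp_minus_to_infinity[OF k] by (intro integrable_on_mult_left)
  have lim: "\<forall>r\<in>{0..}. (\<lambda>N. \<Sum>n<N. C n * t n r) \<longlonglongrightarrow> g r"
    using g_sums by (simp add: sums_def)
  have "g integrable_on {0..}"
       "(\<lambda>N. integral {0..} (\<lambda>r. \<Sum>n<N. C n * t n r)) \<longlonglongrightarrow> integral {0..} g"
    using dominated_convergence[of "\<lambda>N r. \<Sum>n<N. C n * t n r" "{0..}" "\<lambda>r. exp (- k * r) * suminf B" g]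
      int h dom lim by (auto simp: integrable_on_def)
  moreover have "integral {0..} (\<lambda>r. \<Sum>n<N. C n * t n r) = (\<Sum>n<N. C n * y n)" for N
    using int by (rule integral_unique)
  ultimately have "has_ray_laplace G \<theta> x (integral {0..} g)" "(\<lambda>n. C n * y n) sums integral {0..} g"
    unfolding has_ray_laplace_def g_def[symmetric] by (simp_all add: sums_def integrable_integral)
  then show ?thesis
    using that unfolding y_def by blast
qed

text \<open>
  The normalisation: \<open>3 * pi / (2 * sqrt 2)\<close> times \<open>m\<close>, divided by \<open>3 * (m * pi / sqrt 6) ^ 3\<close>, is
  \<open>3 * sqrt 3 / (pi\<^sup>2 * m\<^sup>2)\<close>.
\<close>

lemma median_term:
  fixes m :: nat and e :: complex
  assumes "m > 0"
  shows "of_real (3 * pi / (2 * sqrt 2)) * chi12 m * of_nat m *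
           ((4 * of_real (sqrt pi) * e - 2) / (3 * of_real (sqrt_singularity m) ^ 3))
       = of_real (12 * sqrt 3 / pi powr (3/2)) * (chi12 m / of_nat m ^ 2 * e)
         - of_real (6 * sqrt 3 / pi ^ 2) * (chi12 m / of_nat m ^ 2)"
proof -
  have s6: "sqrt 6 = sqrt 2 * sqrt 3"
    by (simp flip: real_sqrt_mult)
  have pow: "pi powr (3/2) = pi * sqrt pi"
    using powr_add[of pi 1 "1/2"] by (simp add: powr_half_sqrt)
  have "3 * pi / (2 * sqrt 2) * real m / (3 * sqrt_singularity m ^ 3)
        = 3 * sqrt 3 / (pi ^ 2 * real m ^ 2)"
    using assms by (simp add: sqrt_singularity_def s6 field_simps power_numeral_reduce)
  moreover have "complex_of_real (3 * pi / (2 * sqrt 2)) * of_nat m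
        / (3 * of_real (sqrt_singularity m) ^ 3)
      = of_real (3 * pi / (2 * sqrt 2) * real m / (3 * sqrt_singularity m ^ 3))"
    by (simp only: of_real_mult of_real_divide of_real_power of_real_numeral of_real_of_nat_eq)
  ultimately have *: "complex_of_real (3 * pi / (2 * sqrt 2)) * of_nat m
        / (3 * of_real (sqrt_singularity m) ^ 3)
      = of_real (3 * sqrt 3 / (pi ^ 2 * real m ^ 2))"
    by (simp only:)
  have **: "12 * sqrt 3 / pi powr (3/2) = 3 * sqrt 3 / pi ^ 2 * (4 * sqrt pi)"
    by (simp add: pow field_simps power2_eq_square)
  have "of_real (3 * pi / (2 * sqrt 2)) * chi12 m * of_nat m *
           ((4 * of_real (sqrt pi) * e - 2) / (3 * of_real (sqrt_singularity m) ^ 3))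
       = complex_of_real (3 * pi / (2 * sqrt 2)) * of_nat m / (3 * of_real (sqrt_singularity m) ^ 3)
          * (chi12 m * (4 * of_real (sqrt pi) * e - 2))"
    by simp
  also have "\<dots> = of_real (3 * sqrt 3 / pi ^ 2 * (4 * sqrt pi)) * (chi12 m / of_nat m ^ 2 * e)
         - of_real (6 * sqrt 3 / pi ^ 2) * (chi12 m / of_nat m ^ 2)"
    unfolding * using assms by (simp add: field_simps)
  finally show ?thesis
    by (simp only: **)
qed

theorem theorem4:
  fixes x :: complex
  assumes "Re x > 0"
  shows "summable (\<lambda>n. chi12 (Suc n) / of_nat (Suc n) ^ 2 *
                        calE (of_nat (Suc n) * of_real pi * csqrt (x / 6))) \<and>
         has_median_laplace G x
           (of_real (12 * sqrt 3 / pi powr (3/2)) *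
              (\<Sum>n. chi12 (Suc n) / of_nat (Suc n) ^ 2 *
                     calE (of_nat (Suc n) * of_real pi * csqrt (x / 6))) - 1)"
proof -
  define b where "b = (\<lambda>n. sqrt_singularity (Suc n))"
  define C where "C = (\<lambda>n. of_real (3 * pi / (2 * sqrt 2)) * chi12 (Suc n) * of_nat (Suc n))"
  define M where "M = (\<lambda>n. (4 * of_real (sqrt pi) * calE (of_real (b n) * csqrt x) - 2)
        / (3 * of_real (b n) ^ 3))"
  define W where "W = (\<lambda>n. 4 / 3 * \<i> * of_real (sqrt pi) * csqrt x ^ 3 * exp (- of_real (b n ^ 2) * x))"
  define I where "I = (\<Sum>n. C n * (M n + W n))"
  define J where "J = (\<Sum>n. C n * (M n - W n))"
  define u where "u = (\<lambda>n. chi12 (Suc n) / of_nat (Suc n) ^ 2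
        * calE (of_nat (Suc n) * of_real pi * csqrt (x / 6)))"
  define \<alpha> where "\<alpha> = complex_of_real (12 * sqrt 3 / pi powr (3/2))"
  define \<beta> where "\<beta> = complex_of_real (6 * sqrt 3 / pi ^ 2)"

  \<comment> \<open>The rays lie in the half plane of convergence once \<open>\<theta>\<close> is small.\<close>
  have near: "\<forall>\<^sub>F \<theta> in at_right 0. Re (x * cis (s * \<theta>)) > 0" for s :: real
  proof (rule order_tendstoD)
    have "((\<lambda>\<theta>. Re (x * cis (s * \<theta>))) \<longlongrightarrow> Re (x * cis (s * 0))) (at_right 0)"
      by (intro tendsto_intros)
    then show "((\<lambda>\<theta>. Re (x * cis (s * \<theta>))) \<longlongrightarrow> Re x) (at_right 0)" by simp
  qed fact
  have "\<forall>\<^sub>F \<theta> in at_right 0. 0 < \<theta> \<and> \<theta> < pi"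
    by (auto simp: eventually_at_right_field intro!: exI[of _ pi])
  then have both: "\<forall>\<^sub>F \<theta> in at_right 0.
      (has_ray_laplace G \<theta> x I \<and> (\<lambda>n. C n * (M n + W n)) sums I) \<and>
      (has_ray_laplace G (- \<theta>) x J \<and> (\<lambda>n. C n * (M n - W n)) sums J)"
    using near[of 1] near[of "-1"]
  proof eventually_elim
    case (elim \<theta>)
    have s: "sin \<theta> > 0" using elim by (intro sin_gt_zero) auto
    obtain I' where I': "has_ray_laplace G \<theta> x I'" "(\<lambda>n. C n * (M n + W n)) sums I'"
    proof (rule ray_laplace_G[OF assms, of \<theta>], goal_cases)
      case (3 I')
      then show ?case
        using that[of I'] s unfolding C_def M_def W_def b_def by simp
    qed (use elim s in auto)
    obtain J' where J': "has_ray_laplace G (- \<theta>) x J'" "(\<lambda>n. C n * (M n - W n)) sums J'"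
    proof (rule ray_laplace_G[OF assms, of "- \<theta>"], goal_cases)
      case (3 J')
      then show ?case
        using that[of J'] s unfolding C_def M_def W_def b_def by simp
    qed (use elim s in auto)
    from I' J' show ?case
      unfolding I_def J_def by (simp add: sums_iff)
  qed
  \<comment> \<open>One admissible angle is enough to see that the lateral series converge.\<close>
  then obtain \<theta> where "has_ray_laplace G \<theta> x I" and sums: "(\<lambda>n. C n * (M n + W n)) sums I"
        "(\<lambda>n. C n * (M n - W n)) sums J"
    using eventually_happens[OF both] trivial_limit_at_right_real by blast
  have "(\<lambda>n. (C n * (M n + W n) + C n * (M n - W n)) / 2) sums ((I + J) / 2)"
    by (intro sums_divide sums_add sums)
  also have "(\<lambda>n. (C n * (M n + W n) + C n * (M n - W n)) / 2)
      = (\<lambda>n. \<alpha> * u n - \<beta> * (chi12 (Suc n) / of_nat (Suc n) ^ 2))"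
  proof
    fix n
    have "(C n * (M n + W n) + C n * (M n - W n)) / 2 = C n * M n"
      by (simp add: algebra_simps)
    also have "\<dots> = \<alpha> * (chi12 (Suc n) / of_nat (Suc n) ^ 2 * calE (of_real (b n) * csqrt x))
        - \<beta> * (chi12 (Suc n) / of_nat (Suc n) ^ 2)"
      unfolding C_def M_def b_def \<alpha>_def \<beta>_def by (rule median_term) simp
    also have "of_real (b n) * csqrt x = of_nat (Suc n) * of_real pi * csqrt (x / 6)"
      by (simp add: b_def sqrt_singularity_def csqrt_divide_6 del: of_nat_Suc csqrt.simps)
    finally show "(C n * (M n + W n) + C n * (M n - W n)) / 2
        = \<alpha> * u n - \<beta> * (chi12 (Suc n) / of_nat (Suc n) ^ 2)"
      by (simp only: u_def)
  qed
  finally have "(\<lambda>n. \<alpha> * u n - \<beta> * (chi12 (Suc n) / of_nat (Suc n) ^ 2)) sums ((I + J) / 2)" .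
  moreover have "(\<lambda>n. \<beta> * (chi12 (Suc n) / of_nat (Suc n) ^ 2)) sums 1"
  proof -
    have "\<beta> * of_real (pi ^ 2 / (6 * sqrt 3)) = 1"
      unfolding \<beta>_def of_real_mult[symmetric] by simp
    with sums_mult[OF chi12_L2, of \<beta>] show ?thesis by (simp only:)
  qed
  ultimately have "(\<lambda>n. (\<alpha> * u n - \<beta> * (chi12 (Suc n) / of_nat (Suc n) ^ 2))
      + \<beta> * (chi12 (Suc n) / of_nat (Suc n) ^ 2)) sums ((I + J) / 2 + 1)"
    by (rule sums_add)
  then have "(\<lambda>n. \<alpha> * u n) sums ((I + J) / 2 + 1)"
    by simp
  moreover have "\<alpha> \<noteq> 0" by (simp add: \<alpha>_def)
  ultimately have "u sums (((I + J) / 2 + 1) / \<alpha>)"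
    using sums_mult_D by blast
  then have "summable u" "\<alpha> * suminf u - 1 = (I + J) / 2"
    using \<open>\<alpha> \<noteq> 0\<close> by (auto simp: sums_iff)
  moreover have "has_median_laplace G x ((I + J) / 2)"
    unfolding has_median_laplace_def
    by (intro exI[of _ I] exI[of _ J] conjI eventually_mono[OF both]) auto
  ultimately have "summable u \<and> has_median_laplace G x (\<alpha> * suminf u - 1)"
    by (simp only:)
  then show ?thesis
    unfolding u_def \<alpha>_def .
qed

end
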